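(* Let $x_\ast=(x_{\ast,1},\ldots,x_{\ast,n})^T\in\mathcal{E}$ be an equilibrium on the horizon for the desingularized vector field $g$, i.e. $g(x_\ast)=0$. Assume that $C_\ast:=G(x_\ast)$ is positive, so that $r_{x_\ast}:=(kC_\ast)^{-1/k}>0$ is well-defined. Then the vector $$Y_0:=r_{x_\ast}^{\Lambda_\alpha}x_\ast=(r_{x_\ast}^{\alpha_1}x_{\ast,1},\ldots,r_{x_\ast}^{\alpha_n}x_{\ast,n})^T$$ is a root of the balance law $$-\tfrac1k\Lambda_\alpha Y_0+f_{\alpha,k}(Y_0)=0 .$$ Conversely, let $Y_0\neq 0$ be a root of the balance law $-\tfrac1k\Lambda_\alpha Y_0+f_{\alpha,k}(Y_0)=0$. Then the vector $$x_\ast:=r_{Y_0}^{-\Lambda_\alpha}Y_0=(r_{Y_0}^{-\alpha_1}Y_{0,1},\ldots,r_{Y_0}^{-\alpha_n}Y_{0,n})^T,\qquad r_{Y_0}:=p(Y_0)>0,$$ is an equilibrium on the horizon for $g$, i.e. $x_\ast\in\mathcal{E}$ and $g(x_\ast)=0$.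
   Context: Let $n\ge1$, $\alpha=(\alpha_1,\ldots,\alpha_n)$ positive integers, $k>0$ real, $\Lambda_\alpha=\mathrm{diag}(\alpha_1,\ldots,\alpha_n)$, and $s^{\Lambda_\alpha}=\mathrm{diag}(s^{\alpha_1},\ldots,s^{\alpha_n})$ for $s>0$. The map $f:\mathbb{R}^n\to\mathbb{R}^n$ is $C^r$ with $r\ge2$ (it defines the ODE $y'=f(y)$) and is asymptotically quasi-homogeneous of type $\alpha$ and order $k+1$ at infinity: there is a quasi-homogeneous vector field $f_{\alpha,k}=(f_{1;\alpha,k},\ldots,f_{n;\alpha,k})^T$, i.e. $f_{i;\alpha,k}(s^{\Lambda_\alpha}x)=s^{k+\alpha_i}f_{i;\alpha,k}(x)$ for all $x\in\mathbb{R}^n$, $s>0$, such that for each $i$, $f_i(s^{\Lambda_\alpha}x)-s^{k+\alpha_i}f_{i;\alpha,k}(x)=o(s^{k+\alpha_i})$ as $s\to+\infty$, uniformly for $x$ in the unit sphere $S^{n-1}$. ($f_{\alpha,k}$ is continuous.) Quasi-parabolic compactification: $c$ is the least common multiple of $\alpha_1,\ldots,\alpha_n$, $\beta_i=c/\alpha_i$, $p(x)=\big(\sum_{i=1}^n x_i^{2\beta_i}\big)^{1/(2c)}$, $\mathcal{D}=\{p<1\}$, horizon $\mathcal{E}=\{p=1\}$, $\overline{\mathcal{D}}=\{p\le1\}$, $\kappa(x)=(1-p(x)^{2c})^{-1}$ on $\mathcal D$; original and new variables are related by $y=\kappa(x)^{\Lambda_\alpha}x$. On $\mathcal{D}$ put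 $\tilde f_i(x)=\kappa^{-(k+\alpha_i)}f_i(\kappa^{\Lambda_\alpha}x)$, extended continuously to $\mathcal{E}$ by $\tilde f=f_{\alpha,k}$. Put $G(x)=\sum_{j=1}^n\frac{x_j^{2\beta_j-1}}{\alpha_j}\tilde f_j(x)$. The desingularized vector field on $\overline{\mathcal{D}}$ is $$g(x)=\Big(1-\tfrac{2c-1}{2c}(1-p(x)^{2c})\Big)\tilde f(x)-G(x)\Lambda_\alpha x .$$ *)

theory Defs
  imports "HOL-Analysis.Analysis"
begin

(* C^r on the whole space. In finite dimension, C^r-ness of all the maps x |-> f' x v is the
   same as C^r-ness of the derivative x |-> f' x. *)
fun C_r :: "nat \<Rightarrow> ('a::euclidean_space \<Rightarrow> 'b::real_normed_vector) \<Rightarrow> bool" where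
  "C_r 0 f \<longleftrightarrow> continuous_on UNIV f"
| "C_r (Suc r) f \<longleftrightarrow>
     (\<exists>f'. (\<forall>x. (f has_derivative f' x) (at x)) \<and> (\<forall>v. C_r r (\<lambda>x. f' x v)))"

definition Lam :: "('n \<Rightarrow> nat) \<Rightarrow> real^'n^'n" where
  "Lam \<alpha> = (\<chi> i j. if i = j then real (\<alpha> i) else 0)"

(* s^A = exp (A ln s); the formula is meant only for s > 0 and diagonal A,
   here A = Lam \<alpha> or A = - Lam \<alpha>. *)
definition diag_pow :: "real \<Rightarrow> real^'n^'n \<Rightarrow> real^'n^'n" where
  "diag_pow s A = (\<chi> i j. if i = j then s powr (A $ i $ i) else 0)"

lemma diag_pow_Lam_nth:
  assumes "s > 0"
  shows "(diag_pow s (Lam \<alpha>) *v x) $ i = s ^ \<alpha> i * x $ i"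
    and "(diag_pow s (- Lam \<alpha>) *v x) $ i = x $ i / s ^ \<alpha> i"
  using assms
  by (simp_all add: diag_pow_def Lam_def matrix_vector_mult_def if_distrib[of "\<lambda>a. a * _"]
      powr_realpow powr_minus divide_simps cong: if_cong)

definition quasi_homogeneous ::
    "('n \<Rightarrow> nat) \<Rightarrow> real \<Rightarrow> (real^'n \<Rightarrow> real^'n) \<Rightarrow> bool" where
  "quasi_homogeneous \<alpha> k h \<longleftrightarrow>
     (\<forall>x s i. s > 0 \<longrightarrow> h (diag_pow s (Lam \<alpha>) *v x) $ i = s powr (k + real (\<alpha> i)) * h x $ i)"

(* f is asymptotically quasi-homogeneous of type \<alpha> and order k + 1 at infinity,
   with quasi-homogeneous part fk *)
definition asymp_quasi_homogeneous ::
    "('n \<Rightarrow> nat) \<Rightarrow> real \<Rightarrow> (real^'n \<Rightarrow> real^'n) \<Rightarrow> (real^'n \<Rightarrow> real^'n) \<Rightarrow> bool" where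
  "asymp_quasi_homogeneous \<alpha> k f fk \<longleftrightarrow>
     quasi_homogeneous \<alpha> k fk \<and>
     (\<forall>i. \<forall>\<epsilon>>0. \<forall>\<^sub>F s in at_top. \<forall>x\<in>sphere 0 1.
        \<bar>f (diag_pow s (Lam \<alpha>) *v x) $ i - s powr (k + real (\<alpha> i)) * fk x $ i\<bar>
          \<le> \<epsilon> * s powr (k + real (\<alpha> i)))"

definition cc :: "('n \<Rightarrow> nat) \<Rightarrow> nat" where
  "cc \<alpha> = (LCM i. \<alpha> i)"

definition bet :: "('n \<Rightarrow> nat) \<Rightarrow> 'n \<Rightarrow> nat" where
  "bet \<alpha> i = cc \<alpha> div \<alpha> i"

definition pp :: "('n::finite \<Rightarrow> nat) \<Rightarrow> real^'n \<Rightarrow> real" where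
  "pp \<alpha> x = (\<Sum>i\<in>UNIV. (x $ i) ^ (2 * bet \<alpha> i)) powr (1 / (2 * real (cc \<alpha>)))"

definition disk :: "('n::finite \<Rightarrow> nat) \<Rightarrow> (real^'n) set" where
  "disk \<alpha> = {x. pp \<alpha> x < 1}"

definition horizon :: "('n::finite \<Rightarrow> nat) \<Rightarrow> (real^'n) set" where
  "horizon \<alpha> = {x. pp \<alpha> x = 1}"

definition kappa :: "('n::finite \<Rightarrow> nat) \<Rightarrow> real^'n \<Rightarrow> real" where
  "kappa \<alpha> x = inverse (1 - pp \<alpha> x ^ (2 * cc \<alpha>))"

(* f_tilde, G_fun and desing are meaningful on the closed disk {x. pp \<alpha> x \<le> 1} only;
   their values elsewhere are junk. *)
definition f_tilde ::
    "('n::finite \<Rightarrow> nat) \<Rightarrow> real \<Rightarrow> (real^'n \<Rightarrow> real^'n) \<Rightarrow> (real^'n \<Rightarrow> real^'n) \<Rightarrow> real^'n \<Rightarrow> real^'n" where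
  "f_tilde \<alpha> k f fk x =
     (if x \<in> disk \<alpha>
      then (\<chi> i. kappa \<alpha> x powr (- (k + real (\<alpha> i))) * f (diag_pow (kappa \<alpha> x) (Lam \<alpha>) *v x) $ i)
      else fk x)"

definition G_fun ::
    "('n::finite \<Rightarrow> nat) \<Rightarrow> real \<Rightarrow> (real^'n \<Rightarrow> real^'n) \<Rightarrow> (real^'n \<Rightarrow> real^'n) \<Rightarrow> real^'n \<Rightarrow> real" where
  "G_fun \<alpha> k f fk x =
     (\<Sum>j\<in>UNIV. (x $ j) ^ (2 * bet \<alpha> j - 1) / real (\<alpha> j) * f_tilde \<alpha> k f fk x $ j)"

definition desing ::
    "('n::finite \<Rightarrow> nat) \<Rightarrow> real \<Rightarrow> (real^'n \<Rightarrow> real^'n) \<Rightarrow> (real^'n \<Rightarrow> real^'n) \<Rightarrow> real^'n \<Rightarrow> real^'n" where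
  "desing \<alpha> k f fk x =
     (1 - (2 * real (cc \<alpha>) - 1) / (2 * real (cc \<alpha>)) * (1 - pp \<alpha> x ^ (2 * cc \<alpha>)))
       *\<^sub>R f_tilde \<alpha> k f fk x
     - G_fun \<alpha> k f fk x *\<^sub>R (Lam \<alpha> *v x)"

definition balance_root ::
    "('n::finite \<Rightarrow> nat) \<Rightarrow> real \<Rightarrow> (real^'n \<Rightarrow> real^'n) \<Rightarrow> real^'n \<Rightarrow> bool" where
  "balance_root \<alpha> k fk Y \<longleftrightarrow> - ((1 / k) *\<^sub>R (Lam \<alpha> *v Y)) + fk Y = 0"

end

(* Both conditions are the single relation fk x = C * Lam x: on the horizon the factor C in
   g x = 0 is forced to be G x (Euler's identity for the level set p = 1), and under the scaling
   x |-> s^Lam x the factor is multiplied by s^k, so that, if C > 0, exactly one point of the orbit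
   of x has factor 1 / k and exactly one lies on the horizon. *)
theory Submission
  imports Defs
begin

lemma cc_pos:
  fixes \<alpha> :: "'n::finite \<Rightarrow> nat"
  assumes "\<And>i. \<alpha> i > 0"
  shows "cc \<alpha> > 0"
proof -
  \<comment> \<open>Since \<open>'n\<close> is finite, the Lcm over the range can vanish only if 0
    is itself one of the values.\<close>
  have "Lcm (range \<alpha>) \<noteq> 0"
    using assms by (subst Lcm_0_iff) (auto simp: image_iff)
  then show ?thesis
    unfolding cc_def by (rule bot_nat_0.not_eq_extremum[THEN iffD1])
qed

lemma mult_bet: "\<alpha> i * bet \<alpha> i = cc \<alpha>"
  unfolding bet_def cc_def by (intro dvd_mult_div_cancel dvd_Lcm) simp

lemma bet_pos:
  fixes \<alpha> :: "'n::finite \<Rightarrow> nat"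
  assumes "\<And>i. \<alpha> i > 0"
  shows "bet \<alpha> i > 0"
  using mult_bet[of \<alpha> i] cc_pos[of \<alpha>, OF assms] by (metis gr0I mult_0_right)

lemma Lam_mult_nth: "(Lam \<alpha> *v x) $ i = real (\<alpha> i) * x $ i"
  by (simp add: Lam_def matrix_vector_mult_def if_distrib[of "\<lambda>a. a * _"] cong: if_cong)

lemma diag_pow_Lam_uminus:
  assumes "s > 0"
  shows "diag_pow s (Lam \<alpha>) *v (diag_pow s (- Lam \<alpha>) *v x) = x"
  using assms by (simp add: vec_eq_iff diag_pow_Lam_nth)

lemma pp_power:
  assumes "\<And>i. \<alpha> i > 0"
  shows "pp \<alpha> x ^ (2 * cc \<alpha>) = (\<Sum>i\<in>UNIV. (x $ i) ^ (2 * bet \<alpha> i))"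
proof -
  have "(\<Sum>i\<in>UNIV. (x $ i) ^ (2 * bet \<alpha> i)) \<ge> 0"
    by (intro sum_nonneg) (simp add: power_mult)
  then show ?thesis
    using cc_pos[of \<alpha>, OF assms]
    by (cases "(\<Sum>i\<in>UNIV. (x $ i) ^ (2 * bet \<alpha> i)) = 0") (simp_all add: pp_def powr_power)
qed

lemma pp_nonneg: "pp \<alpha> x \<ge> 0"
  by (simp add: pp_def)

lemma pp_pos:
  assumes "\<And>i. \<alpha> i > 0" and "x \<noteq> 0"
  shows "pp \<alpha> x > 0"
proof -
  obtain i where "x $ i \<noteq> 0"
    using assms(2) by (auto simp: vec_eq_iff)
  then have "(\<Sum>i\<in>UNIV. (x $ i) ^ (2 * bet \<alpha> i)) > 0"
    by (intro sum_pos2[of _ i]) (simp_all add: power_mult)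
  then show ?thesis
    by (simp add: pp_def)
qed

text \<open>The exponents are balanced by \<alpha>_i * \<beta>_i = c: every monomial of p^(2c) picks
  up the same factor s^(2c). Both sides are nonnegative, so comparing their 2c-th powers
  suffices.\<close>

lemma pp_diag_pow:
  assumes "\<And>i. \<alpha> i > 0" and "s > 0"
  shows "pp \<alpha> (diag_pow s (Lam \<alpha>) *v x) = s * pp \<alpha> x"
proof (rule power_eq_imp_eq_base)
  have "(s ^ \<alpha> i) ^ (2 * bet \<alpha> i) = s ^ (2 * cc \<alpha>)" for i
    by (simp flip: power_mult mult_bet[of \<alpha> i] add: ac_simps)
  then show "pp \<alpha> (diag_pow s (Lam \<alpha>) *v x) ^ (2 * cc \<alpha>) = (s * pp \<alpha> x) ^ (2 * cc \<alpha>)"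
    using assms
    by (simp add: power_mult_distrib pp_power diag_pow_Lam_nth sum_distrib_left)
qed (use assms cc_pos[of \<alpha>] pp_nonneg[of \<alpha>] in auto)

text \<open>Component i of \<open>h\<close> scales by s^(k + \<alpha>_i), that of Lam x only by
  s^\<alpha>_i; the surplus s^k moves into the factor. As s > 0, all these powers cancel, so the
  relation travels both ways along an orbit.\<close>

lemma quasi_homogeneous_eq_Lam_scale:
  assumes "quasi_homogeneous \<alpha> k h" and "s > 0"
  shows "h (diag_pow s (Lam \<alpha>) *v x) = (s powr k * C) *\<^sub>R (Lam \<alpha> *v (diag_pow s (Lam \<alpha>) *v x))
     \<longleftrightarrow> h x = C *\<^sub>R (Lam \<alpha> *v x)"
  using assms
  by (simp add: vec_eq_iff quasi_homogeneous_def Lam_mult_nth diag_pow_Lam_nth powr_add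
      powr_realpow ac_simps)

lemma balance_root_iff: "balance_root \<alpha> k fk Y \<longleftrightarrow> fk Y = (1 / k) *\<^sub>R (Lam \<alpha> *v Y)"
  by (auto simp: balance_root_def)

text \<open>At p = 1 the scalar in front of \<open>f_tilde\<close> becomes 1, and a point outside
  the open disk falls into the branch where \<open>f_tilde\<close> is \<open>fk\<close>.\<close>

lemma desing_horizon:
  assumes "x \<in> horizon \<alpha>"
  shows "desing \<alpha> k f fk x = fk x - G_fun \<alpha> k f fk x *\<^sub>R (Lam \<alpha> *v x)"
  using assms by (simp add: desing_def horizon_def f_tilde_def disk_def)

text \<open>The weights 1/\<alpha>_j in G cancel the \<alpha>_j of Lam x, which leaves C * p^(2c),
  and p = 1.\<close>

lemma G_fun_horizon:
  assumes "\<And>i. \<alpha> i > 0" and "x \<in> horizon \<alpha>" and "fk x = C *\<^sub>R (Lam \<alpha> *v x)"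
  shows "G_fun \<alpha> k f fk x = C"
proof -
  have "(x $ j) ^ (2 * bet \<alpha> j - 1) / real (\<alpha> j) * fk x $ j = C * (x $ j) ^ (2 * bet \<alpha> j)" for j
  proof -
    have "(x $ j) ^ (2 * bet \<alpha> j) = (x $ j) ^ (2 * bet \<alpha> j - 1) * x $ j"
      \<comment> \<open>The natural-number subtraction in the exponent is harmless only because
        \<beta>_j > 0.\<close>
      using bet_pos[of \<alpha> j, OF assms(1)] by (intro power_minus_mult[symmetric]) simp
    then show ?thesis
      using assms(1)[of j] by (simp add: assms(3) Lam_mult_nth)
  qed
  then have "G_fun \<alpha> k f fk x = C * pp \<alpha> x ^ (2 * cc \<alpha>)"
    using assms(2) pp_power[of \<alpha> x, OF assms(1)]
    by (simp add: G_fun_def f_tilde_def disk_def horizon_def flip: sum_distrib_left)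
  then show ?thesis
    using assms(2) by (simp add: horizon_def)
qed

theorem theorem3p5:
  fixes \<alpha> :: "'n::finite \<Rightarrow> nat" and k :: real and r :: nat
    and f fk :: "real^'n \<Rightarrow> real^'n"
  assumes "\<And>i. \<alpha> i > 0"
    and "k > 0"
    and "r \<ge> 2"
    and "C_r r f"
    and "asymp_quasi_homogeneous \<alpha> k f fk"
    and "continuous_on UNIV fk"
  shows "(\<forall>x. x \<in> horizon \<alpha> \<and> desing \<alpha> k f fk x = 0 \<and> G_fun \<alpha> k f fk x > 0 \<longrightarrow>
            (let rx = (k * G_fun \<alpha> k f fk x) powr (- 1 / k)
             in rx > 0 \<and> balance_root \<alpha> k fk (diag_pow rx (Lam \<alpha>) *v x))) \<and>
         (\<forall>Y. Y \<noteq> 0 \<and> balance_root \<alpha> k fk Y \<longrightarrow>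
            (let rY = pp \<alpha> Y; x = diag_pow rY (- Lam \<alpha>) *v Y
             in rY > 0 \<and> x \<in> horizon \<alpha> \<and> desing \<alpha> k f fk x = 0))"
proof -
  have qh: "quasi_homogeneous \<alpha> k fk"
    using assms(5) by (simp add: asymp_quasi_homogeneous_def)
  have root: "balance_root \<alpha> k fk (diag_pow s (Lam \<alpha>) *v x) \<and> s > 0"
    if x: "x \<in> horizon \<alpha>" "desing \<alpha> k f fk x = 0" and G: "G_fun \<alpha> k f fk x > 0"
      and s: "s = (k * G_fun \<alpha> k f fk x) powr (- 1 / k)" for x s
  proof -
    have "s > 0"
      using G \<open>k > 0\<close> by (simp add: s)
    \<comment> \<open>The exponent -1/k makes s^k = 1/(k G), so the scaling turns the factor G at x
      into the factor 1/k of the balance law.\<close>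
    moreover have "s powr k * G_fun \<alpha> k f fk x = 1 / k"
      using G \<open>k > 0\<close> by (simp add: s powr_powr powr_neg_one)
    moreover have "fk x = G_fun \<alpha> k f fk x *\<^sub>R (Lam \<alpha> *v x)"
      using x by (simp add: desing_horizon)
    ultimately show ?thesis
      using quasi_homogeneous_eq_Lam_scale[OF qh, of s x "G_fun \<alpha> k f fk x"]
      by (simp add: balance_root_iff)
  qed
  have equilibrium: "x \<in> horizon \<alpha> \<and> desing \<alpha> k f fk x = 0 \<and> s > 0"
    if "Y \<noteq> 0" and Y: "balance_root \<alpha> k fk Y"
      and s: "s = pp \<alpha> Y" and x: "x = diag_pow s (- Lam \<alpha>) *v Y" for Y x s
  proof -
    have "s > 0"
      using s pp_pos[OF assms(1) \<open>Y \<noteq> 0\<close>] by simp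
    then have Yx: "diag_pow s (Lam \<alpha>) *v x = Y"
      by (simp add: x diag_pow_Lam_uminus)
    \<comment> \<open>p(Y) is computed twice: it is s by choice and s * p(x) by scaling; cancelling
      s puts x on the horizon.\<close>
    then have "s = s * pp \<alpha> x"
      using pp_diag_pow[of \<alpha> s x, OF assms(1) \<open>s > 0\<close>] s by simp
    then have hor: "x \<in> horizon \<alpha>"
      using \<open>s > 0\<close> by (simp add: horizon_def)
    \<comment> \<open>Going from Y back to x divides the factor 1/k by s^k. This C must then be G(x)
      by \<open>G_fun_horizon\<close>, so g(x) = 0.\<close>
    define C where "C = 1 / (k * s powr k)"
    have "s powr k * C = 1 / k"
      using \<open>s > 0\<close> by (simp add: C_def)
    then have eq: "fk x = C *\<^sub>R (Lam \<alpha> *v x)"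
      using quasi_homogeneous_eq_Lam_scale[OF qh \<open>s > 0\<close>, of x C] Y
      by (simp add: Yx balance_root_iff)
    then have "desing \<alpha> k f fk x = 0"
      using hor G_fun_horizon[of \<alpha> x fk C k f, OF assms(1) hor eq] by (simp add: desing_horizon)
    then show ?thesis
      using hor \<open>s > 0\<close> by blast
  qed
  show ?thesis
    unfolding Let_def using root equilibrium by blast
qed

end
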